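(* There is an algorithm with competitive-ratio $\frac32-\sqrt2$ (i.e. a $(\frac32-\sqrt2)$-competitive algorithm) for two-faced online weighted matching with edge arrivals in general graphs.
   Context: Two-faced online matching with edge arrivals: there is a finite graph $G=(V,E)$ known to the algorithm. For each $e\in E$ the adversary chooses a pair of non-negative weights $f_1(e),f_2(e)$. Independently for each $e\in E$, $s(e)\in\{f_1(e),f_2(e)\}$ is chosen uniformly at random (one of the two faces) and $w(e)$ is the remaining weight. All weights $s(e)$, $e\in E$, are given to the online algorithm upfront as a sample. Then the edges arrive one by one with weights $w(e)$ in an adversarial order (which may depend on the realization of $s$ and $w$); when $e$ arrives, $w(e)$ is revealed and the algorithm must immediately and irrevocably accept $e$ (keeping accepted edges vertex-disjoint) or reject it. $\mathrm{ALG}$ is the total $w$-weight of accepted edges and $\mathrm{OPT}$ is the maximum $w$-weight of a matching in $G$. An algorithm is $c$-competitive if $\mathrm{E}[\mathrm{ALG}]\ge c\cdot\mathrm{E}[\mathrm{OPT}]$ on every instance $(G,f_1,f_2)$, with expectation over the random choice of $s$ (and $w$) and the algorithm's internal randomness. *)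

theory Defs
  imports "HOL-Probability.Probability" "HOL-Combinatorics.Multiset_Permutations"
begin

definition fin_graph :: "'v set \<Rightarrow> 'v set set \<Rightarrow> bool" where
  "fin_graph V E \<longleftrightarrow> finite V \<and> (\<forall>e\<in>E. e \<subseteq> V \<and> card e = 2)"

definition matching :: "'v set set \<Rightarrow> 'v set set \<Rightarrow> bool" where
  "matching E M \<longleftrightarrow> M \<subseteq> E \<and> pairwise disjnt M"

definition opt :: "'v set set \<Rightarrow> ('v set \<Rightarrow> real) \<Rightarrow> real" where
  "opt E w = Max (sum w ` {M. matching E M})"

text \<open>
  The joint law of the pair \<open>(s, w)\<close>, presented as a random function \<open>r\<close> with
  \<open>r e = (s e, w e)\<close>. The coins of distinct edges are independent; outside \<open>E\<close> both
  weights are 0.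
\<close>

definition two_faced :: "'v set set \<Rightarrow> ('v set \<Rightarrow> real) \<Rightarrow> ('v set \<Rightarrow> real) \<Rightarrow>
    ('v set \<Rightarrow> real \<times> real) pmf" where
  "two_faced E f1 f2 = Pi_pmf E (0, 0)
     (\<lambda>e. map_pmf (\<lambda>b. if b then (f1 e, f2 e) else (f2 e, f1 e)) (bernoulli_pmf (1/2)))"

text \<open>
  A deterministic online algorithm sees the whole sample \<open>s\<close>, the edges that arrived earlier
  with their weights (in order of arrival), and the edge arriving now with its weight; it
  answers whether to accept the latter. Its own earlier decisions are determined by these data.
\<close>

type_synonym 'v det_online =
  "('v set \<Rightarrow> real) \<Rightarrow> ('v set \<times> real) list \<Rightarrow> 'v set \<times> real \<Rightarrow> bool"

definition accepted :: "'v det_online \<Rightarrow> ('v set \<Rightarrow> real) \<Rightarrow> ('v set \<times> real) list \<Rightarrow> 'v set set" where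
  "accepted D s xs = {fst (xs ! i) | i. i < length xs \<and> D s (take i xs) (xs ! i)}"

definition arrivals :: "('v set \<Rightarrow> real) \<Rightarrow> 'v set list \<Rightarrow> ('v set \<times> real) list" where
  "arrivals w es = map (\<lambda>e. (e, w e)) es"

definition feasible :: "'v set set \<Rightarrow> 'v det_online \<Rightarrow> bool" where
  "feasible E D \<longleftrightarrow> (\<forall>s w es. (\<forall>e\<in>E. 0 \<le> s e \<and> 0 \<le> w e) \<longrightarrow> es \<in> permutations_of_set E \<longrightarrow>
     matching E (accepted D s (arrivals w es)))"

definition alg_value :: "'v det_online \<Rightarrow> ('v set \<Rightarrow> real) \<Rightarrow> ('v set \<Rightarrow> real) \<Rightarrow> 'v set list \<Rightarrow> real" where
  "alg_value D s w es = (\<Sum>e\<in>accepted D s (arrivals w es). w e)"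

text \<open>
  A randomized online algorithm knows the graph and is a probability distribution over
  deterministic online algorithms (internal randomness drawn independently of the coins for
  the faces). The arrival order \<open>ord s w\<close> is chosen by the adversary with knowledge of the
  realized \<open>s\<close> and \<open>w\<close>, but not of the internal randomness.
\<close>

type_synonym 'v rand_online = "'v set \<Rightarrow> 'v set set \<Rightarrow> 'v det_online pmf"

definition expected_alg :: "'v det_online pmf \<Rightarrow> 'v set set \<Rightarrow> ('v set \<Rightarrow> real) \<Rightarrow> ('v set \<Rightarrow> real) \<Rightarrow>
    (('v set \<Rightarrow> real) \<Rightarrow> ('v set \<Rightarrow> real) \<Rightarrow> 'v set list) \<Rightarrow> real" where
  "expected_alg P E f1 f2 ord =
     measure_pmf.expectation (pair_pmf (two_faced E f1 f2) P)
       (\<lambda>(r, D). alg_value D (fst \<circ> r) (snd \<circ> r) (ord (fst \<circ> r) (snd \<circ> r)))"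

definition expected_opt :: "'v set set \<Rightarrow> ('v set \<Rightarrow> real) \<Rightarrow> ('v set \<Rightarrow> real) \<Rightarrow> real" where
  "expected_opt E f1 f2 = measure_pmf.expectation (two_faced E f1 f2) (\<lambda>r. opt E (snd \<circ> r))"

definition competitive :: "real \<Rightarrow> 'v rand_online \<Rightarrow> bool" where
  "competitive c A \<longleftrightarrow> (\<forall>V E. fin_graph V E \<longrightarrow>
     (\<forall>D\<in>set_pmf (A V E). feasible E D) \<and>
     (\<forall>f1 f2 ord. (\<forall>e\<in>E. 0 \<le> f1 e \<and> 0 \<le> f2 e) \<longrightarrow>
        (\<forall>s w. ord s w \<in> permutations_of_set E) \<longrightarrow>
        expected_alg (A V E) E f1 f2 ord \<ge> c * expected_opt E f1 f2))"

end

theory Submission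
  imports Defs
begin

text \<open>
  Mark every edge independently with probability \<open>p\<close> and give it the weight \<open>x e\<close>, which is
  \<open>s e\<close> for marked and \<open>w e\<close> for unmarked edges. Since the two faces are exchangeable, the marks
  are independent of \<open>x\<close>, and \<open>x\<close> has the law of \<open>w\<close>. Run the greedy matching on the marked
  edges in the order of decreasing \<open>x\<close>; an unmarked edge is a candidate if both its ends are
  still free at its turn. The algorithm accepts candidates first come, first served, so its
  matching \<open>M\<close> is maximal among the candidates \<open>C\<close>, whatever the order of arrival.

  Let \<open>z u\<close> be the weight of the lightest candidate at \<open>u\<close>, and \<open>G\<close> the greedy matching. Then
  \<open>x(M) \<ge> (\<Sum>u. z u) - x(C)\<close>. After each candidate at \<open>u\<close>, the next edge at \<open>u\<close> with free ends
  is marked with probability \<open>p\<close> and then ends the list of candidates at \<open>u\<close>; hence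
  \<open>E (\<Sum>u. z u) \<ge> 2 p E x(C)\<close>. Moreover \<open>p E x(C) = (1 - p) E x(G)\<close>, and \<open>2 E x(G) \<ge> OPT(x)\<close>
  for \<open>p \<ge> 1/2\<close>. The resulting ratio \<open>(2p - 1) (1 - p) / (2p)\<close> is largest for \<open>p = 1 / sqrt 2\<close>.
\<close>

section \<open>Greedy matching and candidates\<close>

text \<open>
  \<open>b\<close> tells which edges are marked, \<open>B\<close> is the set of vertices already matched, and the list is
  meant to be sorted by decreasing weight.
\<close>

fun picks :: "('v set \<Rightarrow> bool) \<Rightarrow> 'v set \<Rightarrow> 'v set list \<Rightarrow> 'v set list" where
  "picks b B [] = []"
| "picks b B (e # es) =
     (if e \<inter> B = {} then if b e then e # picks b (B \<union> e) es else picks b B es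
      else picks b B es)"

fun cands :: "('v set \<Rightarrow> bool) \<Rightarrow> 'v set \<Rightarrow> 'v set list \<Rightarrow> 'v set list" where
  "cands b B [] = []"
| "cands b B (e # es) =
     (if e \<inter> B = {} then if b e then cands b (B \<union> e) es else e # cands b B es
      else cands b B es)"

lemma picks_cong: "(\<And>e. e \<in> set es \<Longrightarrow> b e = b' e) \<Longrightarrow> picks b B es = picks b' B es"
  by (induction es arbitrary: B) auto

lemma cands_cong: "(\<And>e. e \<in> set es \<Longrightarrow> b e = b' e) \<Longrightarrow> cands b B es = cands b' B es"
  by (induction es arbitrary: B) auto

lemma picks_fun_upd [simp]: "e \<notin> set es \<Longrightarrow> picks (b(e := y)) B es = picks b B es"
  by (rule picks_cong) auto

lemma cands_fun_upd [simp]: "e \<notin> set es \<Longrightarrow> cands (b(e := y)) B es = cands b B es"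
  by (rule cands_cong) auto

lemma set_cands_subset: "set (cands b B es) \<subseteq> set es"
  by (induction es arbitrary: B) (auto split: if_splits)

lemma distinct_cands: "distinct es \<Longrightarrow> distinct (cands b B es)"
  using set_cands_subset by (induction es arbitrary: B) fastforce+

lemma sorted_wrt_cands: "sorted_wrt R es \<Longrightarrow> sorted_wrt R (cands b B es)"
  using set_cands_subset by (induction es arbitrary: B) fastforce+

lemma cands_not_sampled: "e \<in> set (cands b B es) \<Longrightarrow> \<not> b e"
  by (induction es arbitrary: B) (auto split: if_splits)

text \<open>Unmarked edges never enter \<open>B\<close>, so deleting all of them except
  \<open>e\<close> leaves the set of free vertices at the turn of \<open>e\<close> as it
  was.\<close>

lemma cands_filter:
  "e \<in> set (cands b B (filter (\<lambda>f. b f \<or> f = e) es)) \<longleftrightarrow> e \<in> set (cands b B es)"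
  by (induction es arbitrary: B) auto

section \<open>Expectations\<close>

lemma expectation_mono_finite:
  fixes f g :: "'a \<Rightarrow> real"
  assumes "finite (set_pmf q)" "\<And>x. x \<in> set_pmf q \<Longrightarrow> f x \<le> g x"
  shows "measure_pmf.expectation q f \<le> measure_pmf.expectation q g"
  by (intro integral_mono_AE integrable_measure_pmf_finite assms) (auto simp: AE_measure_pmf_iff assms)

lemma expectation_pair_finite:
  fixes f :: "'a \<times> 'b \<Rightarrow> real"
  assumes "finite (set_pmf p)" "finite (set_pmf q)"
  shows "measure_pmf.expectation (pair_pmf p q) f =
    measure_pmf.expectation p (\<lambda>x. measure_pmf.expectation q (\<lambda>y. f (x, y)))"
proof -
  have *: "measure_pmf.expectation q (\<lambda>y. f (x, y)) = (\<Sum>y\<in>set_pmf q. f (x, y) * pmf q y)" for x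
    by (rule integral_measure_pmf_real) (use assms in auto)
  have "measure_pmf.expectation (pair_pmf p q) f =
      (\<Sum>z\<in>set_pmf p \<times> set_pmf q. f z * pmf (pair_pmf p q) z)"
    by (rule integral_measure_pmf_real) (use assms in auto)
  also have "\<dots> = (\<Sum>x\<in>set_pmf p. measure_pmf.expectation q (\<lambda>y. f (x, y)) * pmf p x)"
    unfolding * sum_distrib_right sum.cartesian_product by (auto intro!: sum.cong simp: pmf_pair)
  also have "\<dots> = measure_pmf.expectation p (\<lambda>x. measure_pmf.expectation q (\<lambda>y. f (x, y)))"
    by (rule integral_measure_pmf_real[symmetric]) (use assms in auto)
  finally show ?thesis .
qed

definition coins :: "real \<Rightarrow> 'v set set \<Rightarrow> ('v set \<Rightarrow> bool) pmf" where
  "coins p E = Pi_pmf E False (\<lambda>_. bernoulli_pmf p)"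

lemma finite_set_Pi_pmf:
  "finite A \<Longrightarrow> (\<And>x. x \<in> A \<Longrightarrow> finite (set_pmf (q x))) \<Longrightarrow> finite (set_pmf (Pi_pmf A d q))"
  by (simp add: set_Pi_pmf finite_PiE_dflt)

lemma finite_set_coins: "finite E \<Longrightarrow> finite (set_pmf (coins p E))"
  unfolding coins_def by (rule finite_set_Pi_pmf) auto

lemma expectation_coins_insert:
  fixes \<Phi> :: "('v set \<Rightarrow> bool) \<Rightarrow> real"
  assumes "finite E" "e \<notin> E" "0 \<le> p" "p \<le> 1"
  shows "measure_pmf.expectation (coins p (insert e E)) \<Phi> =
    p * measure_pmf.expectation (coins p E) (\<lambda>b. \<Phi> (b(e := True))) +
    (1 - p) * measure_pmf.expectation (coins p E) (\<lambda>b. \<Phi> (b(e := False)))"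
proof -
  have "coins p (insert e E) = map_pmf (\<lambda>(y, b). b(e := y)) (pair_pmf (bernoulli_pmf p) (coins p E))"
    unfolding coins_def using assms by (simp add: Pi_pmf_insert)
  then show ?thesis
    using assms by (simp add: expectation_pair_finite finite_set_coins case_prod_unfold mult.commute)
qed

section \<open>Averages over the marks, for fixed weights\<close>

locale online_matching =
  fixes p :: real
  assumes p: "0 < p" "p \<le> 1"
begin

abbreviation avg :: "'v set list \<Rightarrow> (('v set \<Rightarrow> bool) \<Rightarrow> real) \<Rightarrow> real" where
  "avg es \<Phi> \<equiv> measure_pmf.expectation (coins p (set es)) \<Phi>"

lemma integrable_avg [simp, intro]: "integrable (measure_pmf (coins p (set es))) (\<Phi> :: _ \<Rightarrow> real)"
  by (intro integrable_measure_pmf_finite finite_set_coins) simp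

lemma avg_Cons:
  "e \<notin> set es \<Longrightarrow> measure_pmf.expectation (coins p (insert e (set es))) \<Phi> =
    p * avg es (\<lambda>b. \<Phi> (b(e := True))) + (1 - p) * avg es (\<lambda>b. \<Phi> (b(e := False)))"
  using expectation_coins_insert[of "set es" e p \<Phi>] p by simp

lemma convex_same: "p * a + (1 - p) * a = a"
  by (simp add: algebra_simps)

text \<open>Whether the ends of an edge are free at its turn depends only on earlier marks. An edge
  that finds them free is thus picked with probability \<open>p\<close> and becomes a candidate with
  probability \<open>1 - p\<close>. The induction conditions on the first mark.\<close>

lemma avg_cands:
  assumes "distinct es"
  shows "p * avg es (\<lambda>b. sum_list (map x (cands b B es))) =
    (1 - p) * avg es (\<lambda>b. sum_list (map x (picks b B es)))"
  using assms
proof (induction es arbitrary: B)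
  case (Cons e es)
  let ?C = "\<lambda>B. avg es (\<lambda>b. sum_list (map x (cands b B es)))"
  let ?G = "\<lambda>B. avg es (\<lambda>b. sum_list (map x (picks b B es)))"
  have IH: "p * ?C B = (1 - p) * ?G B" for B
    using Cons by simp
  show ?case
  proof (cases "e \<inter> B = {}")
    case True
    have "p * (p * ?C (B \<union> e) + (1 - p) * (x e + ?C B)) =
        p * (p * ?C (B \<union> e)) + (1 - p) * (p * x e + p * ?C B)"
      by (simp add: algebra_simps)
    also have "\<dots> = (1 - p) * (p * (x e + ?G (B \<union> e)) + (1 - p) * ?G B)"
      unfolding IH by (simp add: algebra_simps)
    finally show ?thesis
      using True Cons.prems by (simp add: avg_Cons)
  next
    case False
    then have "avg (e # es) (\<lambda>b. sum_list (map x (cands b B (e # es)))) = ?C B"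
      "avg (e # es) (\<lambda>b. sum_list (map x (picks b B (e # es)))) = ?G B"
      using Cons.prems by (simp_all add: avg_Cons convex_same)
    then show ?thesis
      using IH[of B] by simp
  qed
qed simp

text \<open>The inequality for \<open>z = 0\<close> is the aim; \<open>z\<close> is the weight of the last candidate met so far.\<close>

lemma avg_last_cand:
  assumes "distinct es" "u \<notin> B" "0 \<le> z"
    and "\<And>e. e \<in> set es \<Longrightarrow> 0 \<le> x e"
  shows "p * (z + avg es (\<lambda>b. sum_list (map x (filter (\<lambda>e. u \<in> e) (cands b B es))))) \<le>
    avg es (\<lambda>b. last (z # map x (filter (\<lambda>e. u \<in> e) (cands b B es))))"
  using assms
proof (induction es arbitrary: B z)
  case Nil
  then show ?case using p by (simp add: mult_left_le_one_le)
next
  case (Cons e es)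
  let ?L = "\<lambda>B z. avg es (\<lambda>b. last (z # map x (filter (\<lambda>e. u \<in> e) (cands b B es))))"
  let ?C = "\<lambda>B. avg es (\<lambda>b. sum_list (map x (filter (\<lambda>e. u \<in> e) (cands b B es))))"
  have IH: "p * (z + ?C B) \<le> ?L B z" if "u \<notin> B" "0 \<le> z" for B z
    using Cons that by simp
  \<comment> \<open>If \<open>u\<close> is not in \<open>e\<close>, both values of the mark leave
    \<open>z\<close> as it is; since \<open>p\<close> and \<open>1 - p\<close> sum to one, the two
    induction hypotheses average to the claim.\<close>
  have split: "p * (z + (p * c + (1 - p) * c')) \<le> p * l + (1 - p) * l'"
    if "p * (z + c) \<le> l" "p * (z + c') \<le> l'" for c c' l l'
  proof -
    have "p * (z + (p * c + (1 - p) * c')) = p * (p * (z + c)) + (1 - p) * (p * (z + c'))"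
      by (simp add: algebra_simps)
    also have "\<dots> \<le> p * l + (1 - p) * l'"
      using p that by (intro add_mono mult_left_mono) auto
    finally show ?thesis .
  qed
  have x: "0 \<le> x e" using Cons.prems by simp
  show ?case
  proof (cases "e \<inter> B = {} \<and> u \<in> e")
    case True
    \<comment> \<open>Marking \<open>e\<close> ends the candidates at \<open>u\<close>, so
      \<open>z\<close> stays the last weight with probability \<open>p\<close>, which pays for
      \<open>p * z\<close>. Without the mark the induction goes on with \<open>x e\<close> in place
      of \<open>z\<close>.\<close>
    have blocked: "filter (\<lambda>f. u \<in> f) (cands b B' es) = []" if "u \<in> B'" for b B'
      using that by (induction es arbitrary: B') auto
    have "p * (z + (1 - p) * (x e + ?C B)) = p * z + (1 - p) * (p * (x e + ?C B))"
      by (simp add: algebra_simps)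
    also have "\<dots> \<le> p * z + (1 - p) * ?L B (x e)"
      using p IH[of B "x e"] x Cons.prems by (intro add_left_mono mult_left_mono) auto
    finally show ?thesis
      using True Cons.prems blocked by (simp add: avg_Cons)
  next
    case False
    show ?thesis
    proof (cases "e \<inter> B = {}")
      case True
      with False show ?thesis
        using Cons.prems split[OF IH[of "B \<union> e" z] IH[of B z]]
        by (simp add: avg_Cons del: last.simps)
    next
      case False
      then show ?thesis
        using Cons.prems IH[of B z] by (simp add: avg_Cons convex_same del: last.simps)
    qed
  qed
qed

text \<open>
  An edge of \<open>M\<close> with free ends is picked with probability \<open>p \<ge> 1/2\<close>, and a pick outside \<open>M\<close>
  blocks at most two edges of \<open>M\<close>, neither of them heavier.
\<close>

lemma avg_picks:
  assumes "1 / 2 \<le> p" "distinct es" "sorted_wrt (\<lambda>e f. x f \<le> x e) es"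
    and "\<And>e. e \<in> set es \<Longrightarrow> 0 \<le> x e \<and> card e = 2" and M: "pairwise disjnt M"
  shows "(\<Sum>e | e \<in> M \<inter> set es \<and> e \<inter> B = {}. x e) \<le>
    2 * avg es (\<lambda>b. sum_list (map x (picks b B es)))"
  using assms(2-4)
proof (induction es arbitrary: B)
  case (Cons e es)
  let ?R = "\<lambda>B. \<Sum>f | f \<in> M \<inter> set es \<and> f \<inter> B = {}. x f"
  let ?G = "\<lambda>B. avg es (\<lambda>b. sum_list (map x (picks b B es)))"
  have IH: "?R B \<le> 2 * ?G B" for B
    using Cons by simp
  have e: "0 \<le> x e" "card e = 2" "e \<notin> set es" and le: "\<And>f. f \<in> set es \<Longrightarrow> x f \<le> x e"
    and nonneg: "\<And>f. f \<in> set es \<Longrightarrow> 0 \<le> x f"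
    using Cons.prems by auto
  show ?case
  proof (cases "e \<inter> B = {}")
    case False
    then have "{f. f \<in> M \<inter> set (e # es) \<and> f \<inter> B = {}} = {f. f \<in> M \<inter> set es \<and> f \<inter> B = {}}"
      by auto
    then show ?thesis
      using False IH[of B] e by (simp add: avg_Cons convex_same)
  next
    case True
    have step: "p * (2 * (x e + ?G (B \<union> e))) + (1 - p) * (2 * ?G B) \<ge>
        p * (2 * x e + ?R (B \<union> e)) + (1 - p) * ?R B"
      using p IH[of B] IH[of "B \<union> e"] by (intro add_mono mult_left_mono) auto
    have "p * (2 * x e + ?R (B \<union> e)) + (1 - p) * ?R B \<ge>
        (\<Sum>f | f \<in> M \<inter> set (e # es) \<and> f \<inter> B = {}. x f)"
    proof (cases "e \<in> M")
      case eM: True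
      \<comment> \<open>As \<open>M\<close> is a matching, picking \<open>e\<close> blocks no other
        edge of \<open>M\<close>.\<close>
      then have "f \<inter> e = {}" if "f \<in> M" "f \<in> set es" for f
        using that M eM e(3) unfolding pairwise_def disjnt_def by metis
      then have R: "?R (B \<union> e) = ?R B"
        by (intro sum.cong) auto
      have "{f. f \<in> M \<inter> set (e # es) \<and> f \<inter> B = {}} =
          insert e {f. f \<in> M \<inter> set es \<and> f \<inter> B = {}}"
        using True eM by auto
      then have "(\<Sum>f | f \<in> M \<inter> set (e # es) \<and> f \<inter> B = {}. x f) = x e + ?R B"
        using e(3) by simp
      \<comment> \<open>Here \<open>p >= 1/2\<close> enters: twice the weight of \<open>e\<close>,
        gained with probability \<open>p\<close>, covers \<open>x e\<close>.\<close>
      also have "\<dots> \<le> p * (2 * x e) + ?R B"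
        using assms(1) e(1) mult_right_mono[of "1/2" p "x e"] by simp
      finally show ?thesis
        unfolding R by (simp add: algebra_simps)
    next
      case False
      then have eq: "{f. f \<in> M \<inter> set (e # es) \<and> f \<inter> B = {}} = {f. f \<in> M \<inter> set es \<and> f \<inter> B = {}}"
        by auto
      define N where "N = {f \<in> M \<inter> set es. f \<inter> e \<noteq> {}}"
      have "\<exists>u. u \<in> f \<inter> e" if "f \<in> N" for f
        using that by (auto simp: N_def)
      \<comment> \<open>Distinct edges of \<open>M\<close> meet \<open>e\<close> in distinct
        vertices, so \<open>h\<close> embeds \<open>N\<close> into the two-element set
        \<open>e\<close>.\<close>
      then obtain h where h: "\<And>f. f \<in> N \<Longrightarrow> h f \<in> f \<inter> e"
        by metis
      have "inj_on h N"
      proof (rule inj_onI)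
        fix f g assume fg: "f \<in> N" "g \<in> N" "h f = h g"
        then have "\<not> disjnt f g" using h[of f] h[of g] by (auto simp: disjnt_def)
        then show "f = g" using fg M by (auto simp: N_def pairwise_def)
      qed
      moreover have "finite e" using e(2) card.infinite by fastforce
      ultimately have "card N \<le> 2"
        using card_inj_on_le[of h N e] h e(2) by auto
      have "?R B \<le> ?R (B \<union> e) + sum x N"
      proof -
        have "?R B \<le> sum x ({f. f \<in> M \<inter> set es \<and> f \<inter> (B \<union> e) = {}} \<union> N)"
          by (rule sum_mono2) (auto simp: N_def nonneg)
        also have "\<dots> \<le> ?R (B \<union> e) + sum x N"
          by (subst sum.union_disjoint) (auto simp: N_def)
        finally show ?thesis .
      qed
      also have "sum x N \<le> real (card N) * x e"
        by (rule sum_bounded_above) (auto simp: N_def le)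
      also have "\<dots> \<le> 2 * x e"
        using \<open>card N \<le> 2\<close> e(1) by (intro mult_right_mono) auto
      finally have "p * ?R B \<le> p * (2 * x e + ?R (B \<union> e))"
        using p by (intro mult_left_mono) auto
      then show ?thesis
        unfolding eq by (simp add: algebra_simps)
    qed
    with step show ?thesis
      using True e by (simp add: avg_Cons algebra_simps)
  qed
qed simp

end

section \<open>The online algorithm\<close>

text \<open>
  Every edge of \<open>M\<close> pays twice for its ends. An unmatched vertex is paid by its lightest edge,
  which is outside \<open>M\<close> and, as its other end is matched by maximality, pays only once.
\<close>

lemma maximal_matching_bound:
  fixes x :: "'v set \<Rightarrow> real"
  assumes "finite V" "finite C" and C: "\<And>e. e \<in> C \<Longrightarrow> e \<subseteq> V \<and> card e = 2 \<and> 0 \<le> x e"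
    and M: "M \<subseteq> C" "pairwise disjnt M"
    and maximal: "\<And>e. e \<in> C \<Longrightarrow> \<exists>f\<in>M. \<not> disjnt e f"
    and z_le: "\<And>e u. e \<in> C \<Longrightarrow> u \<in> e \<Longrightarrow> z u \<le> x e"
    and z_attained: "\<And>u. z u = 0 \<or> (\<exists>e\<in>C. u \<in> e \<and> z u = x e)"
  shows "sum z V \<le> sum x M + sum x C"
proof -
  have finM: "finite M" using M(1) assms(2) finite_subset by blast
  have fin: "finite e" if "e \<in> C" for e
    using C[OF that] assms(1) finite_subset by blast
  define U where "U = {u \<in> V - \<Union>M. z u \<noteq> 0}"
  have "\<exists>e\<in>C. u \<in> e \<and> z u = x e" if "u \<in> U" for u
    using z_attained[of u] that by (auto simp: U_def)
  then obtain c where c: "\<And>u. u \<in> U \<Longrightarrow> c u \<in> C \<and> u \<in> c u \<and> z u = x (c u)"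
    by metis
  \<comment> \<open>Two unmatched vertices with the same lightest edge would be its two ends, and
    this edge would then be disjoint from all of \<open>M\<close>.\<close>
  have "inj_on c U"
  proof (rule inj_onI, rule ccontr)
    fix u v assume uv: "u \<in> U" "v \<in> U" "c u = c v" "u \<noteq> v"
    have "{u, v} \<subseteq> c u" "card (c u) = 2"
      using c[OF uv(1)] c[OF uv(2)] uv(3) C by auto
    moreover have "card {u, v} = 2" using uv(4) by simp
    ultimately have "c u = {u, v}"
      using card_subset_eq[of "c u" "{u, v}"] fin c[OF uv(1)] by metis
    moreover obtain f where "f \<in> M" "\<not> disjnt (c u) f"
      using maximal c[OF uv(1)] by blast
    ultimately show False
      using uv by (auto simp: U_def disjnt_def)
  qed
  then have "sum x (c ` U) = (\<Sum>u\<in>U. x (c u))"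
    by (simp add: sum.reindex)
  also have "\<dots> = sum z U"
    by (rule sum.cong) (use c in auto)
  finally have "sum z U = sum x (c ` U)" by simp
  also have "\<dots> \<le> sum x (C - M)"
  proof (rule sum_mono2)
    show "c ` U \<subseteq> C - M"
    proof
      fix e assume "e \<in> c ` U"
      then obtain u where u: "u \<in> U" "e = c u" by blast
      then have "u \<in> e" "e \<in> C" using c by blast+
      then show "e \<in> C - M" using u(1) by (auto simp: U_def)
    qed
  qed (use assms(2) C in auto)
  finally have unmatched: "sum z U \<le> sum x C - sum x M"
    using M(1) assms(2) by (simp add: sum_diff)
  have "sum z (\<Union>M) = (\<Sum>f\<in>M. sum z f)"
  proof (subst sum.Union_disjoint)
    show "\<forall>A\<in>M. finite A" using M(1) fin by blast
    show "\<forall>A\<in>M. \<forall>B\<in>M. A \<noteq> B \<longrightarrow> A \<inter> B = {}"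
      using M(2) by (simp add: pairwise_def disjnt_def)
  qed simp
  also have "\<dots> \<le> (\<Sum>f\<in>M. 2 * x f)"
  proof (rule sum_mono)
    fix f assume f: "f \<in> M"
    have "sum z f \<le> real (card f) * x f"
      by (rule sum_bounded_above) (use f M(1) z_le in auto)
    then show "sum z f \<le> 2 * x f" using f M(1) C by auto
  qed
  finally have matched: "sum z (\<Union>M) \<le> 2 * sum x M"
    by (simp add: sum_distrib_left)
  have "V = \<Union>M \<union> (V - \<Union>M)" using M(1) C by blast
  then have "sum z V = sum z (\<Union>M) + sum z (V - \<Union>M)"
    using sum.union_disjoint[of "\<Union>M" "V - \<Union>M" z] assms(1) by (metis Diff_disjoint finite_Un)
  also have "sum z (V - \<Union>M) = sum z U"
    by (rule sum.mono_neutral_right) (use assms(1) in \<open>auto simp: U_def\<close>)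
  finally show ?thesis
    using matched unmatched by linarith
qed

section \<open>First come, first served\<close>

definition first_come :: "('v set \<times> real \<Rightarrow> bool) \<Rightarrow> ('v set \<times> real) list \<Rightarrow> 'v set set" where
  "first_come P ys =
     foldl (\<lambda>M y. if P y \<and> (\<forall>f\<in>M. disjnt f (fst y)) then insert (fst y) M else M) {} ys"

lemma first_come_Nil [simp]: "first_come P [] = {}"
  by (simp add: first_come_def)

lemma first_come_snoc [simp]:
  "first_come P (ys @ [y]) =
     (if P y \<and> (\<forall>f\<in>first_come P ys. disjnt f (fst y)) then insert (fst y) (first_come P ys)
      else first_come P ys)"
  by (simp add: first_come_def)

lemma first_come_subset: "first_come P ys \<subseteq> fst ` {y \<in> set ys. P y}"
  by (induction ys rule: rev_induct) (auto split: if_splits)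

lemma first_come_disjnt: "pairwise disjnt (first_come P ys)"
  by (induction ys rule: rev_induct) (auto simp: pairwise_insert disjnt_sym)

lemma first_come_maximal:
  "y \<in> set ys \<Longrightarrow> P y \<Longrightarrow> fst y \<noteq> {} \<Longrightarrow> \<exists>f\<in>first_come P ys. \<not> disjnt (fst y) f"
proof (induction ys rule: rev_induct)
  case (snoc y' ys)
  show ?case
  proof (cases "y = y'")
    case True
    with snoc.prems show ?thesis by (auto simp: disjnt_def)
  next
    case False
    with snoc have "\<exists>f\<in>first_come P ys. \<not> disjnt (fst y) f" by simp
    then show ?thesis by auto
  qed
qed simp

text \<open>No record of earlier decisions is passed along, so the rule replays
  \<open>first_come\<close> on the earlier arrivals to recover its own matching.\<close>

definition first_come_online ::
    "(('v set \<Rightarrow> real) \<Rightarrow> 'v set \<times> real \<Rightarrow> bool) \<Rightarrow> 'v det_online" where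
  "first_come_online P s ys y \<longleftrightarrow> P s y \<and> (\<forall>f\<in>first_come (P s) ys. disjnt f (fst y))"

lemma accepted_snoc:
  "accepted D s (ys @ [y]) = accepted D s ys \<union> (if D s ys y then {fst y} else {})"
proof -
  let ?A = "\<lambda>zs. {i \<in> {..<length zs}. D s (take i zs) (zs ! i)}"
  have image: "accepted D s zs = (\<lambda>i. fst (zs ! i)) ` ?A zs" for zs
    by (auto simp: accepted_def)
  have "?A (ys @ [y]) = ?A ys \<union> (if D s ys y then {length ys} else {})"
    by (intro set_eqI) (simp add: nth_append less_Suc_eq conj_disj_distribR cong: conj_cong)
  moreover have "(\<lambda>i. fst ((ys @ [y]) ! i)) ` ?A ys = (\<lambda>i. fst (ys ! i)) ` ?A ys"
    by (intro image_cong) (simp_all add: nth_append)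
  ultimately show ?thesis
    unfolding image by (simp add: image_Un)
qed

lemma accepted_first_come: "accepted (first_come_online P) s ys = first_come (P s) ys"
proof (induction ys rule: rev_induct)
  case Nil
  then show ?case by (simp add: accepted_def)
next
  case (snoc y ys)
  then show ?case by (auto simp: accepted_snoc first_come_online_def)
qed

section \<open>Recognizing candidates online; the value of the accepted matching\<close>

definition edge_list :: "'v set set \<Rightarrow> 'v set list" where
  "edge_list E = (SOME es. set es = E \<and> distinct es)"

lemma edge_list: "finite E \<Longrightarrow> set (edge_list E) = E \<and> distinct (edge_list E)"
  unfolding edge_list_def by (rule someI_ex) (rule finite_distinct_list)

lemma insort_key_cong:
  "(\<And>f. f \<in> insert e (set es) \<Longrightarrow> g f = h f) \<Longrightarrow> insort_key g e es = insort_key h e es"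
  by (induction es) auto

lemma sort_key_cong:
  "(\<And>e. e \<in> set es \<Longrightarrow> g e = h e) \<Longrightarrow> sort_key g es = sort_key h es"
  by (induction es) (auto intro: insort_key_cong)

text \<open>Sorting one fixed enumeration stably breaks ties alike for all weightings, so the order
  within a subset of edges depends only on the weights there.\<close>

definition by_weight :: "'v set set \<Rightarrow> ('v set \<Rightarrow> real) \<Rightarrow> 'v set list" where
  "by_weight E x = sort_key (\<lambda>e. - x e) (edge_list E)"

lemma set_by_weight [simp]: "finite E \<Longrightarrow> set (by_weight E x) = E"
  and distinct_by_weight [simp]: "finite E \<Longrightarrow> distinct (by_weight E x)"
  by (simp_all add: by_weight_def edge_list)

lemma sorted_by_weight: "sorted_wrt (\<lambda>e f. x f \<le> x e) (by_weight E x)"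
  using sorted_sort_key[of "\<lambda>e. - x e" "edge_list E"] by (simp add: by_weight_def sorted_map)

text \<open>
  When \<open>e\<close> arrives, the remaining weights \<open>w f\<close> of the other unmarked edges may be unknown. Their
  positions do not influence whether \<open>e\<close> is a candidate, so \<open>s f\<close> can stand in for them.
\<close>

definition candidate ::
    "'v set set \<Rightarrow> ('v set \<Rightarrow> bool) \<Rightarrow> ('v set \<Rightarrow> real) \<Rightarrow> 'v set \<times> real \<Rightarrow> bool" where
  "candidate E b s y \<longleftrightarrow> fst y \<in> set (cands b {} (by_weight E (s(fst y := snd y))))"

abbreviation online :: "'v set set \<Rightarrow> ('v set \<Rightarrow> bool) \<Rightarrow> 'v det_online" where
  "online E b \<equiv> first_come_online (candidate E b)"

definition mix :: "('v set \<Rightarrow> bool) \<Rightarrow> ('v set \<Rightarrow> real) \<Rightarrow> ('v set \<Rightarrow> real) \<Rightarrow> 'v set \<Rightarrow> real" where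
  "mix b s w e = (if b e then s e else w e)"

text \<open>A marked edge is never a candidate. For an unmarked \<open>e\<close>, only the marked
  edges and \<open>e\<close> itself matter by \<open>cands_filter\<close>, and on these
  \<open>s(e := w e)\<close> agrees with \<open>mix b s w\<close>.\<close>

lemma candidate_iff:
  "candidate E b s (e, w e) \<longleftrightarrow> e \<in> set (cands b {} (by_weight E (mix b s w)))"
proof (cases "b e")
  case True
  then have "e \<notin> set (cands b {} es)" for es
    using cands_not_sampled[of e b "{}" es] by blast
  then show ?thesis by (simp add: candidate_def)
next
  case False
  have "filter (\<lambda>f. b f \<or> f = e) (by_weight E (s(e := w e))) =
      filter (\<lambda>f. b f \<or> f = e) (by_weight E (mix b s w))"
    unfolding by_weight_def filter_sort by (rule sort_key_cong) (use False in \<open>auto simp: mix_def\<close>)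
  then show ?thesis
    using cands_filter[of e b "{}" "by_weight E (s(e := w e))"]
      cands_filter[of e b "{}" "by_weight E (mix b s w)"]
    by (simp add: candidate_def)
qed

lemma feasible_online:
  assumes "finite E"
  shows "feasible E (online E b)"
  unfolding feasible_def
proof (intro allI impI)
  fix s w :: "'a set \<Rightarrow> real" and es
  assume "es \<in> permutations_of_set E"
  then have "fst ` set (arrivals w es) = E"
    by (simp add: arrivals_def image_image permutations_of_set_def)
  then have "first_come (candidate E b s) (arrivals w es) \<subseteq> E"
    using first_come_subset[of "candidate E b s" "arrivals w es"] by blast
  then show "matching E (accepted (online E b) s (arrivals w es))"
    by (simp add: matching_def accepted_first_come first_come_disjnt)
qed

text \<open>On a list of decreasing weight this is the lightest weight at \<open>u\<close>; the
  leading 0 serves vertices without candidates.\<close>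

definition last_weight :: "('v set \<Rightarrow> real) \<Rightarrow> 'v set list \<Rightarrow> 'v \<Rightarrow> real" where
  "last_weight x cs u = last (0 # map x (filter (\<lambda>e. u \<in> e) cs))"

lemma last_weight_attained:
  "last_weight x cs u = 0 \<or> (\<exists>e\<in>set cs. u \<in> e \<and> last_weight x cs u = x e)"
proof (cases "filter (\<lambda>e. u \<in> e) cs = []")
  case False
  from last_in_set[OF this] show ?thesis
    using False by (auto simp: last_weight_def last_map)
qed (simp add: last_weight_def)

lemma last_weight_le:
  assumes "sorted_wrt (\<lambda>e f. x f \<le> x e) cs" "e \<in> set cs" "u \<in> e"
  shows "last_weight x cs u \<le> x e"
proof -
  let ?l = "filter (\<lambda>e. u \<in> e) cs"
  have e: "e \<in> set ?l" using assms by simp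
  then have ne: "?l \<noteq> []" by (metis empty_iff empty_set)
  have "sorted_wrt (\<lambda>e f. x f \<le> x e) (butlast ?l @ [last ?l])"
    using assms(1) ne by (simp add: sorted_wrt_filter)
  moreover have "e \<in> set (butlast ?l @ [last ?l])" using e ne by simp
  ultimately have "x (last ?l) \<le> x e"
    by (auto simp: sorted_wrt_append)
  then show ?thesis
    using ne by (simp add: last_weight_def last_map)
qed

lemma fin_graphD:
  assumes "fin_graph V E"
  shows "finite V" "finite E" "\<And>e. e \<in> E \<Longrightarrow> e \<subseteq> V \<and> card e = 2"
proof -
  show "finite V" "\<And>e. e \<in> E \<Longrightarrow> e \<subseteq> V \<and> card e = 2"
    using assms by (simp_all add: fin_graph_def)
  then show "finite E"
    by (intro finite_subset[of E "Pow V"]) auto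
qed

text \<open>Accepted edges are unmarked, so \<open>w\<close> is \<open>x\<close> on them, and they
  form a maximal matching among the candidates. The bound involves the weights only through
  \<open>x\<close>, and not the arrival order, as the exchange of faces will require.\<close>

lemma alg_value_ge:
  assumes "fin_graph V E" "es \<in> permutations_of_set E" "\<And>e. e \<in> E \<Longrightarrow> 0 \<le> mix b s w e"
  defines "x \<equiv> mix b s w"
  defines "cs \<equiv> cands b {} (by_weight E x)"
  shows "sum (last_weight x cs) V - sum_list (map x cs) \<le> alg_value (online E b) s w es"
proof -
  note V = fin_graphD(1,2)[OF assms(1)] and E = fin_graphD(3)[OF assms(1)]
  have cs: "set cs \<subseteq> E" "distinct cs" "sorted_wrt (\<lambda>e f. x f \<le> x e) cs"
    unfolding cs_def
    using set_cands_subset[of b "{}" "by_weight E x"] V(2)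
    by (simp_all add: distinct_cands sorted_wrt_cands sorted_by_weight)
  let ?M = "first_come (candidate E b s) (arrivals w es)"
  have arr: "fst ` {y \<in> set (arrivals w es). candidate E b s y} = set cs"
  proof -
    have cand: "candidate E b s (e, w e) \<longleftrightarrow> e \<in> set cs" for e
      unfolding cs_def x_def by (rule candidate_iff)
    have "fst ` {y \<in> set (arrivals w es). candidate E b s y} =
        fst ` {y \<in> (\<lambda>e. (e, w e)) ` E. candidate E b s y}"
      by (simp add: arrivals_def permutations_of_setD(1)[OF assms(2)])
    also have "\<dots> = fst ` (\<lambda>e. (e, w e)) ` {e \<in> E. candidate E b s (e, w e)}"
      by (simp only: Compr_image_eq)
    also have "\<dots> = {e \<in> E. candidate E b s (e, w e)}"
      by (simp add: image_image)
    also have "\<dots> = {e \<in> E. e \<in> set cs}"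
      by (simp only: cand)
    also have "\<dots> = set cs"
      using cs(1) by blast
    finally show ?thesis .
  qed
  have M: "?M \<subseteq> set cs" using first_come_subset arr by metis
  have "alg_value (online E b) s w es = sum w ?M"
    by (simp add: alg_value_def accepted_first_come)
  also have "\<dots> = sum x ?M"
  proof (rule sum.cong)
    fix e assume "e \<in> ?M"
    then have "e \<in> set cs" using M by blast
    then have "\<not> b e" unfolding cs_def by (rule cands_not_sampled)
    then show "w e = x e" by (simp add: x_def mix_def)
  qed simp
  finally have alg: "alg_value (online E b) s w es = sum x ?M" .
  have "sum (last_weight x cs) V \<le> sum x ?M + sum x (set cs)"
  proof (rule maximal_matching_bound)
    show "?M \<subseteq> set cs" by (rule M)
    show "pairwise disjnt ?M" by (rule first_come_disjnt)
    show "e \<subseteq> V \<and> card e = 2 \<and> 0 \<le> x e" if "e \<in> set cs" for e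
      using E[of e] assms(3)[of e] subsetD[OF cs(1) that] by (simp add: x_def)
    show "last_weight x cs u \<le> x e" if "e \<in> set cs" "u \<in> e" for e u
      by (rule last_weight_le[OF cs(3) that])
    show "last_weight x cs u = 0 \<or> (\<exists>e\<in>set cs. u \<in> e \<and> last_weight x cs u = x e)" for u
      by (rule last_weight_attained)
    show "\<exists>f\<in>?M. \<not> disjnt e f" if e: "e \<in> set cs" for e
    proof -
      obtain y where y: "y \<in> set (arrivals w es)" "candidate E b s y" "e = fst y"
        using equalityD2[OF arr, THEN subsetD, OF e] by blast
      have "e \<noteq> {}" using E[of e] subsetD[OF cs(1) e] by auto
      then show ?thesis
        unfolding y(3) by (rule first_come_maximal[where P = "candidate E b s", OF y(1,2)])
    qed
  qed (use V in auto)
  then show ?thesis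
    using alg cs(2) by (simp add: sum_list_distinct_conv_sum_set)
qed

section \<open>Expected payoff for fixed weights\<close>

lemma sum_incident_weight:
  fixes x :: "'v set \<Rightarrow> real"
  assumes "finite V" "\<And>e. e \<in> set cs \<Longrightarrow> e \<subseteq> V \<and> card e = 2"
  shows "(\<Sum>u\<in>V. sum_list (map x (filter (\<lambda>e. u \<in> e) cs))) = 2 * sum_list (map x cs)"
  using assms(2)
proof (induction cs)
  case (Cons e cs)
  have "(\<Sum>u\<in>V. sum_list (map x (filter (\<lambda>e. u \<in> e) (e # cs)))) =
      (\<Sum>u\<in>V. (if u \<in> e then x e else 0) + sum_list (map x (filter (\<lambda>e. u \<in> e) cs)))"
    by (intro sum.cong) auto
  also have "\<dots> = (\<Sum>u\<in>V. if u \<in> e then x e else 0) + 2 * sum_list (map x cs)"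
    using Cons by (simp add: sum.distrib)
  also have "(\<Sum>u\<in>V. if u \<in> e then x e else 0) = (\<Sum>u\<in>e. x e)"
    using Cons.prems[of e] assms(1) by (simp add: sum.inter_restrict[symmetric] Int_absorb1)
  finally show ?case
    using Cons.prems[of e] by simp
qed simp

lemma opt_attained:
  assumes "finite E"
  obtains M where "matching E M" "opt E w = sum w M"
proof -
  have "finite {M. matching E M}"
    by (rule finite_subset[of _ "Pow E"]) (use assms in \<open>auto simp: matching_def\<close>)
  moreover have "matching E {}" by (simp add: matching_def)
  ultimately have "opt E w \<in> sum w ` {M. matching E M}"
    unfolding opt_def by (intro Max_in) auto
  then show ?thesis using that by auto
qed

definition payoff :: "'v set \<Rightarrow> ('v set \<Rightarrow> real) \<Rightarrow> 'v set list \<Rightarrow> real" where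
  "payoff V x cs = sum (last_weight x cs) V - sum_list (map x cs)"

text \<open>With \<open>C\<close> and \<open>G\<close> the expected weights of candidates and picks,
  the expected payoff is at least \<open>(2 * p - 1) * C\<close>, while
  \<open>C = (1 - p) / p * G\<close> and \<open>opt E x <= 2 * G\<close>.\<close>

lemma (in online_matching) expected_payoff_ge:
  assumes "1 / 2 \<le> p" "fin_graph V E" "\<And>e. e \<in> E \<Longrightarrow> 0 \<le> x e"
  shows "(2 * p - 1) * (1 - p) / (2 * p) * opt E x \<le>
    measure_pmf.expectation (coins p E) (\<lambda>b. payoff V x (cands b {} (by_weight E x)))"
proof -
  note V = fin_graphD(1,2)[OF assms(2)] and E = fin_graphD(3)[OF assms(2)]
  define es where "es = by_weight E x"
  have es: "set es = E" "distinct es" "sorted_wrt (\<lambda>e f. x f \<le> x e) es"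
    using V(2) sorted_by_weight by (simp_all add: es_def)
  define C where "C = avg es (\<lambda>b. sum_list (map x (cands b {} es)))"
  define G where "G = avg es (\<lambda>b. sum_list (map x (picks b {} es)))"
  let ?I = "\<lambda>u b. sum_list (map x (filter (\<lambda>e. u \<in> e) (cands b {} es)))"
  have "p * (2 * C) = p * avg es (\<lambda>b. \<Sum>u\<in>V. ?I u b)"
    using set_cands_subset[of _ "{}" es] es(1) E V(1)
    by (subst sum_incident_weight) (auto simp: C_def)
  also have "\<dots> = (\<Sum>u\<in>V. p * avg es (?I u))"
    by (simp add: Bochner_Integration.integral_sum sum_distrib_left)
  also have "\<dots> \<le> (\<Sum>u\<in>V. avg es (\<lambda>b. last_weight x (cands b {} es) u))"
    unfolding last_weight_def
    by (intro sum_mono order.trans[OF _ avg_last_cand]) (use es assms(3) in auto)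
  also have "\<dots> = avg es (\<lambda>b. sum (last_weight x (cands b {} es)) V)"
    by (simp add: Bochner_Integration.integral_sum)
  finally have last: "p * (2 * C) \<le> avg es (\<lambda>b. sum (last_weight x (cands b {} es)) V)" .
  obtain M where M: "matching E M" "opt E x = sum x M"
    using opt_attained V(2) by blast
  have "{e. e \<in> M \<inter> set es \<and> e \<inter> {} = {}} = M"
    using M(1) es(1) by (auto simp: matching_def)
  with avg_picks[OF assms(1) es(2,3), of M "{}"] have "opt E x \<le> 2 * G"
    using M assms(3) E es(1) by (auto simp: matching_def G_def)
  moreover have "C = (1 - p) / p * G"
    using avg_cands[OF es(2), of x "{}"] p by (simp add: C_def G_def field_simps)
  ultimately have "(1 - p) / (2 * p) * opt E x \<le> C"
    using p mult_left_mono[of "opt E x" "2 * G" "(1 - p) / (2 * p)"] by simp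
  then have "(2 * p - 1) * ((1 - p) / (2 * p) * opt E x) \<le> (2 * p - 1) * C"
    using assms(1) by (intro mult_left_mono) auto
  also have "\<dots> \<le> avg es (\<lambda>b. payoff V x (cands b {} es))"
    using last by (simp add: payoff_def C_def algebra_simps)
  finally show ?thesis
    by (simp add: es_def V(2))
qed

section \<open>Exchangeability of the faces\<close>

text \<open>The map may vary with the edge because \<open>mix\<close> takes \<open>fst\<close> at
  marked and \<open>snd\<close> at unmarked edges.\<close>

lemma map_Pi_pmf_dependent:
  assumes "finite A" "\<And>e. e \<notin> A \<Longrightarrow> g e d = d'"
  shows "map_pmf (\<lambda>f e. g e (f e)) (Pi_pmf A d P) = Pi_pmf A d' (\<lambda>e. map_pmf (g e) (P e))"
proof -
  have "Pi_pmf A d' (\<lambda>e. map_pmf (g e) (P e)) =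
      map_pmf (\<lambda>f e. if e \<in> A then g e (f e) else d') (Pi_pmf A d P)"
    unfolding map_pmf_def by (simp add: Pi_pmf_bind[OF assms(1), where d' = d] assms(1))
  also have "\<dots> = map_pmf (\<lambda>f e. g e (f e)) (Pi_pmf A d P)"
    using set_Pi_pmf_subset[OF assms(1), of d P] assms(2) by (intro map_pmf_cong) fastforce+
  finally show ?thesis by simp
qed

lemma map_Not_bernoulli_half: "map_pmf Not (bernoulli_pmf (1 / 2)) = bernoulli_pmf (1 / 2)"
proof (rule pmf_eqI)
  fix c
  \<comment> \<open>Writing \<open>c\<close> as a double negation exhibits it as a value of the
    injective map \<open>Not\<close>.\<close>
  have "pmf (map_pmf Not (bernoulli_pmf (1 / 2))) (\<not> (\<not> c)) = pmf (bernoulli_pmf (1 / 2)) (\<not> c)"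
    by (rule pmf_map_inj') (auto simp: inj_def)
  then show "pmf (map_pmf Not (bernoulli_pmf (1 / 2))) c = pmf (bernoulli_pmf (1 / 2)) c"
    by (cases c) simp_all
qed

text \<open>For fixed marks, the fair coin of each edge gives both coordinates the same law; the
  edges are independent, so choosing a coordinate edge by edge preserves the joint law.\<close>

lemma mix_two_faced:
  assumes "finite E"
  shows "map_pmf (\<lambda>r. mix b (fst \<circ> r) (snd \<circ> r)) (two_faced E f1 f2) =
    map_pmf (\<lambda>r. snd \<circ> r) (two_faced E f1 f2)"
proof -
  let ?B = "bernoulli_pmf (1 / 2)"
  let ?P = "\<lambda>e. map_pmf (\<lambda>c. if c then (f1 e, f2 e) else (f2 e, f1 e)) ?B"
  have "map_pmf fst (?P e) = map_pmf snd (?P e)" for e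
  proof -
    have "map_pmf snd (?P e) = map_pmf (\<lambda>c. if c then f2 e else f1 e) ?B"
      by (auto simp: map_pmf_comp intro!: map_pmf_cong)
    also have "\<dots> = map_pmf (\<lambda>c. if c then f2 e else f1 e) (map_pmf Not ?B)"
      by (simp only: map_Not_bernoulli_half)
    also have "\<dots> = map_pmf fst (?P e)"
      by (auto simp: map_pmf_comp intro!: map_pmf_cong)
    finally show ?thesis by simp
  qed
  then have "map_pmf (if b e then fst else snd) (?P e) = map_pmf snd (?P e)" for e
    by simp
  then have "Pi_pmf E 0 (\<lambda>e. map_pmf (if b e then fst else snd) (?P e)) = Pi_pmf E 0 (\<lambda>e. map_pmf snd (?P e))"
    by (intro Pi_pmf_cong) auto
  moreover have "map_pmf (\<lambda>r e. (if b e then fst else snd) (r e)) (two_faced E f1 f2) =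
      Pi_pmf E 0 (\<lambda>e. map_pmf (if b e then fst else snd) (?P e))"
    unfolding two_faced_def by (rule map_Pi_pmf_dependent) (use assms in auto)
  moreover have "map_pmf (\<lambda>r e. snd (r e)) (two_faced E f1 f2) = Pi_pmf E 0 (\<lambda>e. map_pmf snd (?P e))"
    unfolding two_faced_def by (rule map_Pi_pmf_dependent) (use assms in auto)
  moreover have "(\<lambda>r. mix b (fst \<circ> r) (snd \<circ> r)) = (\<lambda>r e. (if b e then fst else snd) (r e))"
    by (auto simp: mix_def fun_eq_iff)
  ultimately show ?thesis by (simp add: o_def)
qed

lemma set_two_faced:
  assumes "finite E"
  shows "set_pmf (two_faced E f1 f2) \<subseteq>
    {r. \<forall>e\<in>E. r e = (f1 e, f2 e) \<or> r e = (f2 e, f1 e)}"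
  unfolding two_faced_def using set_Pi_pmf_subset'[OF assms]
  by (fastforce simp: PiE_dflt_def split: if_splits)

lemma finite_set_two_faced: "finite E \<Longrightarrow> finite (set_pmf (two_faced E f1 f2))"
  unfolding two_faced_def by (rule finite_set_Pi_pmf) auto

text \<open>The optimum is measured in \<open>w\<close>, the payoff of the algorithm in
  \<open>x\<close>. Exchanging the expectations fixes the marks first, and then \<open>x\<close> may
  replace \<open>w\<close> because their laws agree.\<close>

lemma (in online_matching) competitive_online:
  assumes "1 / 2 \<le> p"
  shows "competitive ((2 * p - 1) * (1 - p) / (2 * p)) (\<lambda>V E. map_pmf (online E) (coins p E))"
  unfolding competitive_def
proof (intro allI impI conjI)
  fix V :: "'a set" and E
  assume G: "fin_graph V E"
  note E = fin_graphD(2)[OF G]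
  show "\<forall>D\<in>set_pmf (map_pmf (online E) (coins p E)). feasible E D"
    using feasible_online[OF E] by auto
  fix f1 f2 :: "'a set \<Rightarrow> real" and ord :: "('a set \<Rightarrow> real) \<Rightarrow> ('a set \<Rightarrow> real) \<Rightarrow> 'a set list"
  assume f: "\<forall>e\<in>E. 0 \<le> f1 e \<and> 0 \<le> f2 e" and ord: "\<forall>s w. ord s w \<in> permutations_of_set E"
  let ?c = "(2 * p - 1) * (1 - p) / (2 * p)"
  let ?T = "two_faced E f1 f2"
  let ?h = "\<lambda>x b. payoff V x (cands b {} (by_weight E x))"
  let ?mix = "\<lambda>b r. mix b (fst \<circ> r) (snd \<circ> r)"
  have fin: "finite (set_pmf ?T)" "finite (set_pmf (coins p E))"
    using E by (simp_all add: finite_set_two_faced finite_set_coins)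
  have nonneg: "0 \<le> fst (r e)" "0 \<le> snd (r e)" if "r \<in> set_pmf ?T" "e \<in> E" for r e
    using set_two_faced[OF E, of f1 f2] f that by fastforce+
  have "?c * expected_opt E f1 f2 = measure_pmf.expectation ?T (\<lambda>r. ?c * opt E (snd \<circ> r))"
    by (simp add: expected_opt_def)
  also have "\<dots> \<le> measure_pmf.expectation ?T (\<lambda>r. measure_pmf.expectation (coins p E) (?h (snd \<circ> r)))"
    by (rule expectation_mono_finite[OF fin(1)], rule expected_payoff_ge[OF assms G])
      (auto intro: nonneg)
  also have "\<dots> = measure_pmf.expectation (pair_pmf ?T (coins p E)) (\<lambda>(r, b). ?h (snd \<circ> r) b)"
    by (simp add: expectation_pair_finite fin)
  also have "\<dots> = measure_pmf.expectation (pair_pmf (coins p E) ?T) (\<lambda>(b, r). ?h (snd \<circ> r) b)"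
    by (subst pair_commute_pmf) (simp add: case_prod_unfold)
  also have "\<dots> = measure_pmf.expectation (coins p E)
      (\<lambda>b. measure_pmf.expectation (map_pmf (\<lambda>r. snd \<circ> r) ?T) (\<lambda>x. ?h x b))"
    by (simp add: expectation_pair_finite fin)
  also have "\<dots> = measure_pmf.expectation (coins p E)
      (\<lambda>b. measure_pmf.expectation (map_pmf (?mix b) ?T) (\<lambda>x. ?h x b))"
    by (simp only: mix_two_faced[OF E])
  also have "\<dots> = measure_pmf.expectation (pair_pmf (coins p E) ?T) (\<lambda>(b, r). ?h (?mix b r) b)"
    by (simp add: expectation_pair_finite fin)
  also have "\<dots> = measure_pmf.expectation (pair_pmf ?T (coins p E)) (\<lambda>(r, b). ?h (?mix b r) b)"
    by (subst pair_commute_pmf) (simp add: case_prod_unfold)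
  \<comment> \<open>This bound holds outcome by outcome, so it covers an order chosen with knowledge
    of \<open>s\<close> and \<open>w\<close>.\<close>
  also have "\<dots> \<le> measure_pmf.expectation (pair_pmf ?T (coins p E))
      (\<lambda>(r, b). alg_value (online E b) (fst \<circ> r) (snd \<circ> r) (ord (fst \<circ> r) (snd \<circ> r)))"
  proof (rule expectation_mono_finite)
    fix y assume "y \<in> set_pmf (pair_pmf ?T (coins p E))"
    then obtain r b where y: "y = (r, b)" "r \<in> set_pmf ?T" by auto
    show "(case y of (r, b) \<Rightarrow> ?h (?mix b r) b) \<le> (case y of (r, b) \<Rightarrow>
        alg_value (online E b) (fst \<circ> r) (snd \<circ> r) (ord (fst \<circ> r) (snd \<circ> r)))"
      unfolding y(1) prod.case payoff_def
      by (rule alg_value_ge[OF G]) (use ord nonneg[OF y(2)] in \<open>auto simp: mix_def\<close>)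
  qed (simp add: fin)
  also have "\<dots> = expected_alg (map_pmf (online E) (coins p E)) E f1 f2 ord"
    by (simp add: expected_alg_def pair_map_pmf2 case_prod_unfold)
  finally show "expected_alg (map_pmf (online E) (coins p E)) E f1 f2 ord \<ge> ?c * expected_opt E f1 f2" .
qed

theorem corollary5p9:
  shows "\<exists>A :: 'v rand_online. competitive (3 / 2 - sqrt 2) A"
proof -
  \<comment> \<open>The ratio is \<open>3/2 - (p + 1 / (2 * p))\<close>; the sum in parentheses has
    constant product of its terms and is least when they are equal.\<close>
  define p :: real where "p = 1 / sqrt 2"
  have p: "0 < p" "p \<le> 1" "1 / 2 \<le> p"
    by (simp_all add: p_def real_le_lsqrt field_simps)
  have "(2 * p - 1) * (1 - p) / (2 * p) = 3 / 2 - sqrt 2"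
    by (simp add: p_def field_simps)
  then show ?thesis
    using online_matching.competitive_online[of p] p by (auto simp: online_matching_def)
qed

end
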